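(* If $\pi$ is a (fixed) total ordering pattern of length $k$, and $q=q(n)\ll1$, then, for each $i\in\{1,\dots,n+1-k\}$, as $n\to\infty$, $$\mathbb{P}\big[\text{the consecutive ordering pattern }\pi\text{ occurs at position }i\text{ in }\mathbf{C}_{n,p}\big]\to\frac1{k!}.$$
   Context: An $n$-composition is a sequence of $n$ nonnegative integers. For $p=p(n)\in[0,1)$ and $q=1-p$, the geometric random composition $\mathbf{C}_{n,p}$ is the random $n$-composition whose terms are independent, with $\mathbb{P}[\mathbf{C}_{n,p}(i)=j]=qp^j$ for every $j\ge0$ and $i\in\{1,\dots,n\}$. A total ordering pattern of length $k$ is a permutation $\pi=\pi(1)\ldots\pi(k)$ of $\{0,1,\dots,k-1\}$. The consecutive ordering pattern $\pi$ occurs at position $\ell$ in a composition $C$ if $C(\ell),\ldots,C(\ell-1+k)$ have the same relative order as $\pi(1),\ldots,\pi(k)$; that is, for all $a,b\in\{1,\dots,k\}$, $C(\ell-1+a)<C(\ell-1+b)$ iff $\pi(a)<\pi(b)$, and $C(\ell-1+a)=C(\ell-1+b)$ iff $\pi(a)=\pi(b)$. $q\ll1$ means $\lim_{n\to\infty}q=0$. *)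

theory Defs
  imports "HOL-Probability.Probability"
begin

text \<open>
  An \<open>n\<close>-composition is represented by its term function \<open>C :: nat \<Rightarrow> nat\<close>, with terms
  \<open>C 1, \<dots>, C n\<close>; outside \<open>{1..n}\<close> the value is the irrelevant default \<open>0\<close>.
  The library's \<open>geometric_pmf q\<close> gives \<open>j\<close> the mass \<open>(1 - q) ^ j * q\<close> (for \<open>0 < q \<le> 1\<close>),
  so the success parameter is \<open>q = 1 - p\<close>.
\<close>

definition geometric_composition :: "nat \<Rightarrow> real \<Rightarrow> (nat \<Rightarrow> nat) pmf" where
  "geometric_composition n p = Pi_pmf {1..n} 0 (\<lambda>_. geometric_pmf (1 - p))"

lemma prob_geometric_composition_term:
  assumes "0 \<le> p" "p < 1" "i \<in> {1..n}"
  shows "measure_pmf.prob (geometric_composition n p) {C. C i = j} = (1 - p) * p ^ j"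
proof -
  have "measure_pmf.prob (geometric_composition n p) {C. C i = j}
      = measure_pmf.prob (map_pmf (\<lambda>C. C i) (geometric_composition n p)) {j}"
    by (simp add: vimage_def)
  also have "map_pmf (\<lambda>C. C i) (geometric_composition n p) = geometric_pmf (1 - p)"
    using assms(3) unfolding geometric_composition_def by (subst Pi_pmf_component) auto
  finally show ?thesis
    using assms(1,2) by (simp add: measure_pmf_single)
qed

lemma indep_vars_geometric_composition:
  "prob_space.indep_vars (measure_pmf (geometric_composition n p))
     (\<lambda>_. count_space UNIV) (\<lambda>i C. C i) {1..n}"
  unfolding geometric_composition_def by (rule indep_vars_Pi_pmf) simp

text \<open>Patterns are indexed by \<open>{1..k}\<close>; their values outside this set play no role.\<close>

definition total_ordering_pattern :: "nat \<Rightarrow> (nat \<Rightarrow> nat) \<Rightarrow> bool" where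
  "total_ordering_pattern k \<pi> \<longleftrightarrow> bij_betw \<pi> {1..k} {0..<k}"

definition consecutive_pattern_occurs_at ::
    "nat \<Rightarrow> (nat \<Rightarrow> nat) \<Rightarrow> nat \<Rightarrow> (nat \<Rightarrow> nat) \<Rightarrow> bool" where
  "consecutive_pattern_occurs_at k \<pi> l C \<longleftrightarrow>
     (\<forall>a\<in>{1..k}. \<forall>b\<in>{1..k}.
        (C (l - 1 + a) < C (l - 1 + b) \<longleftrightarrow> \<pi> a < \<pi> b) \<and>
        (C (l - 1 + a) = C (l - 1 + b) \<longleftrightarrow> \<pi> a = \<pi> b))"

end

theory Submission
  imports Defs "HOL-Combinatorics.Permutations"
begin

text \<open>
  The terms in a window of length \<open>k\<close> are independent and identically distributed, so permuting
  them does not change their joint law. Hence each of the \<open>k!\<close> total ordering patterns \<open>\<pi> \<circ> \<tau>\<close>,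
  with \<open>\<tau>\<close> a permutation of \<open>{1..k}\<close>, occurs with the same probability \<open>P\<close>
  (\<open>prob_permuted_pattern\<close>). At most one of these patterns occurs
  (\<open>patterns_comp_permutes_disjoint\<close>), and one does as soon as the terms are distinct
  (\<open>ex_permuted_pattern_occurs\<close>). So \<open>k! P\<close> is the probability that some total ordering
  pattern occurs, and it differs from \<open>1\<close> by at most the probability of a tie.

  Whatever the value of one term, a second, independent term hits it with probability at most the
  largest point mass. For the geometric law this is \<open>q\<close>, so a union bound over the pairs
  of positions shows that ties have probability at most \<open>k\<^sup>2 q\<close>, which tends to \<open>0\<close>.

  All this takes place on \<open>{1..k}\<close>: since the window at position \<open>i\<close> has the law of a geometric
  random \<open>k\<close>-composition (\<open>prob_pattern_window\<close>), the estimate is uniform in \<open>i\<close>,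
  which is why \<open>i\<close> may vary with \<open>n\<close>.
\<close>

section \<open>The pattern formed by a sequence of distinct terms\<close>

text \<open>
  Ranks standardise a sequence: they depend only on the relative order of the terms, and for
  distinct terms they are the total ordering pattern with that order. Existence and uniqueness of
  the occurring pattern both come from this.
\<close>

definition rank_among :: "'a set \<Rightarrow> ('a \<Rightarrow> nat) \<Rightarrow> 'a \<Rightarrow> nat" where
  "rank_among A C a = card {b \<in> A. C b < C a}"

lemma rank_among_less_iff:
  assumes "finite A" "a \<in> A" "b \<in> A"
  shows "rank_among A C a < rank_among A C b \<longleftrightarrow> C a < C b"
proof
  assume "C a < C b"
  then have "{c \<in> A. C c < C a} \<subset> {c \<in> A. C c < C b}"
    using assms(2) by (auto intro: less_trans)
  then show "rank_among A C a < rank_among A C b"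
    unfolding rank_among_def using assms(1) by (intro psubset_card_mono) auto
next
  assume less: "rank_among A C a < rank_among A C b"
  show "C a < C b"
  proof (rule ccontr)
    assume "\<not> C a < C b"
    then have "{c \<in> A. C c < C b} \<subseteq> {c \<in> A. C c < C a}" by auto
    then have "rank_among A C b \<le> rank_among A C a"
      unfolding rank_among_def using assms(1) by (intro card_mono) auto
    with less show False by simp
  qed
qed

lemma bij_betw_rank_among:
  assumes "finite A" "inj_on C A"
  shows "bij_betw (rank_among A C) A {0..<card A}"
proof -
  have "inj_on (rank_among A C) A"
  proof (rule inj_onI)
    fix a b assume ab: "a \<in> A" "b \<in> A" "rank_among A C a = rank_among A C b"
    then have "C a = C b"
      using rank_among_less_iff[OF assms(1), of a b C] rank_among_less_iff[OF assms(1), of b a C]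
      by auto
    then show "a = b" using assms(2) ab by (auto dest: inj_onD)
  qed
  moreover have "rank_among A C ` A \<subseteq> {0..<card A}"
  proof
    fix r assume "r \<in> rank_among A C ` A"
    then obtain a where a: "a \<in> A" "r = rank_among A C a" by auto
    have "{b \<in> A. C b < C a} \<subset> A" using a(1) by auto
    then have "rank_among A C a < card A"
      unfolding rank_among_def using assms(1) by (intro psubset_card_mono)
    with a show "r \<in> {0..<card A}" by simp
  qed
  ultimately have "rank_among A C ` A = {0..<card A}"
    by (intro card_subset_eq) (simp_all add: card_image)
  with \<open>inj_on (rank_among A C) A\<close> show ?thesis
    by (simp add: bij_betw_def)
qed

text \<open>
  The values of a total ordering pattern fill an initial segment of the naturals, so exactly
  \<open>\<pi> a\<close> of them lie below \<open>\<pi> a\<close>.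
\<close>

lemma rank_among_pattern:
  assumes "total_ordering_pattern k \<pi>" "a \<in> {1..k}"
  shows "rank_among {1..k} \<pi> a = \<pi> a"
proof -
  have bij: "bij_betw \<pi> {1..k} {0..<k}"
    using assms(1) by (simp add: total_ordering_pattern_def)
  have "\<pi> a < k" using bij_betwE[OF bij] assms(2) by auto
  have "\<pi> ` {b \<in> {1..k}. \<pi> b < \<pi> a} = {..<\<pi> a}"
  proof
    show "{..<\<pi> a} \<subseteq> \<pi> ` {b \<in> {1..k}. \<pi> b < \<pi> a}"
    proof
      fix r assume r: "r \<in> {..<\<pi> a}"
      with \<open>\<pi> a < k\<close> have "r \<in> \<pi> ` {1..k}"
        using bij_betw_imp_surj_on[OF bij] by auto
      with r show "r \<in> \<pi> ` {b \<in> {1..k}. \<pi> b < \<pi> a}" by auto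
    qed
  qed auto
  moreover have "inj_on \<pi> {b \<in> {1..k}. \<pi> b < \<pi> a}"
    using bij_betw_imp_inj_on[OF bij] by (rule inj_on_subset) auto
  ultimately show ?thesis
    unfolding rank_among_def by (metis card_image card_lessThan)
qed

lemma pattern_occurs_imp_rank_among:
  assumes "total_ordering_pattern k \<pi>" "consecutive_pattern_occurs_at k \<pi> 1 C" "a \<in> {1..k}"
  shows "\<pi> a = rank_among {1..k} C a"
proof -
  have "{b \<in> {1..k}. C b < C a} = {b \<in> {1..k}. \<pi> b < \<pi> a}"
    using assms(2,3) by (auto simp: consecutive_pattern_occurs_at_def)
  then show ?thesis
    using rank_among_pattern[OF assms(1,3)] by (simp add: rank_among_def)
qed

lemma total_ordering_pattern_comp_permutes:
  assumes "total_ordering_pattern k \<pi>" "\<tau> permutes {1..k}"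
  shows "total_ordering_pattern k (\<pi> \<circ> \<tau>)"
  using assms bij_betw_trans[OF permutes_imp_bij[OF assms(2)]]
  by (simp add: total_ordering_pattern_def)

lemma patterns_comp_permutes_disjoint:
  assumes "total_ordering_pattern k \<pi>" "\<sigma> permutes {1..k}" "\<tau> permutes {1..k}"
    and "consecutive_pattern_occurs_at k (\<pi> \<circ> \<sigma>) 1 C"
    and "consecutive_pattern_occurs_at k (\<pi> \<circ> \<tau>) 1 C"
  shows "\<sigma> = \<tau>"
proof
  fix a
  show "\<sigma> a = \<tau> a"
  proof (cases "a \<in> {1..k}")
    case True
    have "(\<pi> \<circ> \<sigma>) a = (\<pi> \<circ> \<tau>) a"
      using pattern_occurs_imp_rank_among[OF total_ordering_pattern_comp_permutes[OF assms(1,2)] assms(4) True]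
        pattern_occurs_imp_rank_among[OF total_ordering_pattern_comp_permutes[OF assms(1,3)] assms(5) True]
      by simp
    moreover have "inj_on \<pi> {1..k}"
      using assms(1) by (auto simp: total_ordering_pattern_def bij_betw_def)
    ultimately show ?thesis
      using True permutes_in_image[OF assms(2)] permutes_in_image[OF assms(3)]
      by (auto dest: inj_onD)
  next
    case False
    then show ?thesis using assms(2,3) by (simp add: permutes_not_in)
  qed
qed

text \<open>
  The ranks of distinct terms form a bijection onto \<open>{0..<k}\<close>, so they equal \<open>\<pi> \<circ> \<tau>\<close>
  for \<open>\<tau> = \<pi>\<inverse> \<circ> rank\<close>.
\<close>

lemma ex_permuted_pattern_occurs:
  assumes "total_ordering_pattern k \<pi>" "inj_on C {1..k}"
  shows "\<exists>\<tau>. \<tau> permutes {1..k} \<and> consecutive_pattern_occurs_at k (\<pi> \<circ> \<tau>) 1 C"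
proof -
  let ?r = "rank_among {1..k} C"
  define \<tau> where "\<tau> a = (if a \<in> {1..k} then inv_into {1..k} \<pi> (?r a) else a)" for a
  have bij: "bij_betw \<pi> {1..k} {0..<k}"
    using assms(1) by (simp add: total_ordering_pattern_def)
  have bij_r: "bij_betw ?r {1..k} {0..<k}"
    using bij_betw_rank_among[OF _ assms(2)] by simp
  have "bij_betw (inv_into {1..k} \<pi> \<circ> ?r) {1..k} {1..k}"
    using bij_r bij_betw_inv_into[OF bij] by (rule bij_betw_trans)
  then have "bij_betw \<tau> {1..k} {1..k}"
    by (rule bij_betw_cong[THEN iffD1, rotated]) (simp add: \<tau>_def)
  then have "\<tau> permutes {1..k}"
    by (rule bij_imp_permutes) (simp only: \<tau>_def if_False)
  moreover have \<pi>\<tau>: "\<pi> (\<tau> a) = ?r a" if "a \<in> {1..k}" for a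
    using that bij_betw_inv_into_right[OF bij] bij_betwE[OF bij_r] by (simp add: \<tau>_def)
  have "C a = C b \<longleftrightarrow> ?r a = ?r b" if "a \<in> {1..k}" "b \<in> {1..k}" for a b
    using that inj_on_eq_iff[OF assms(2) that]
      inj_on_eq_iff[OF bij_betw_imp_inj_on[OF bij_r] that] by simp
  then have "consecutive_pattern_occurs_at k (\<pi> \<circ> \<tau>) 1 C"
    using rank_among_less_iff[of "{1..k}" _ _ C]
    by (simp add: consecutive_pattern_occurs_at_def \<pi>\<tau>)
  ultimately show ?thesis by blast
qed

section \<open>Patterns in independent identically distributed terms\<close>

text \<open>
  Rearranging both the pattern and the terms by \<open>\<tau>\<close> merely relabels positions, so \<open>\<pi> \<circ> \<tau>\<close>
  occurs in \<open>C \<circ> \<tau>\<close> iff \<open>\<pi>\<close> occurs in \<open>C\<close>; and \<open>C \<circ> \<tau>\<close> has the law of \<open>C\<close>.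
\<close>

lemma prob_permuted_pattern:
  assumes "\<tau> permutes {1..k}"
  shows "measure_pmf.prob (Pi_pmf {1..k} d (\<lambda>_. \<mu>)) {C. consecutive_pattern_occurs_at k (\<pi> \<circ> \<tau>) 1 C}
       = measure_pmf.prob (Pi_pmf {1..k} d (\<lambda>_. \<mu>)) {C. consecutive_pattern_occurs_at k \<pi> 1 C}"
proof -
  have occurs: "consecutive_pattern_occurs_at k (\<pi> \<circ> \<tau>) 1 (C \<circ> \<tau>)
      \<longleftrightarrow> consecutive_pattern_occurs_at k \<pi> 1 C" for C
  proof -
    have "(\<forall>a\<in>\<tau> ` {1..k}. \<forall>b\<in>\<tau> ` {1..k}. (C a < C b \<longleftrightarrow> \<pi> a < \<pi> b) \<and> (C a = C b \<longleftrightarrow> \<pi> a = \<pi> b))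
        \<longleftrightarrow> (\<forall>a\<in>{1..k}. \<forall>b\<in>{1..k}. (C a < C b \<longleftrightarrow> \<pi> a < \<pi> b) \<and> (C a = C b \<longleftrightarrow> \<pi> a = \<pi> b))"
      by (simp only: permutes_image[OF assms])
    then show ?thesis by (simp add: consecutive_pattern_occurs_at_def)
  qed
  have "Pi_pmf {1..k} d (\<lambda>_. \<mu>) = map_pmf (\<lambda>C. C \<circ> \<tau>) (Pi_pmf {1..k} d (\<lambda>_. \<mu>))"
    using permutes_imp_bij[OF assms] permutes_not_in[OF assms] by (intro Pi_pmf_bij_betw) auto
  then have "measure_pmf.prob (Pi_pmf {1..k} d (\<lambda>_. \<mu>)) {C. consecutive_pattern_occurs_at k (\<pi> \<circ> \<tau>) 1 C}
      = measure_pmf.prob (map_pmf (\<lambda>C. C \<circ> \<tau>) (Pi_pmf {1..k} d (\<lambda>_. \<mu>)))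
          {C. consecutive_pattern_occurs_at k (\<pi> \<circ> \<tau>) 1 C}"
    by simp
  also have "\<dots> = measure_pmf.prob (Pi_pmf {1..k} d (\<lambda>_. \<mu>)) {C. consecutive_pattern_occurs_at k \<pi> 1 C}"
    using occurs by (simp add: vimage_def)
  finally show ?thesis .
qed

text \<open>
  Draw the coordinate \<open>a\<close> last: given all the others, it must hit the single value \<open>C b\<close>.
\<close>

lemma prob_two_coordinates_eq_le:
  assumes "finite A" "a \<in> A" "a \<noteq> b" "\<And>x. pmf \<mu> x \<le> c"
  shows "measure_pmf.prob (Pi_pmf A d (\<lambda>_. \<mu>)) {C. C a = C b} \<le> c"
proof -
  let ?P = "Pi_pmf (A - {a}) d (\<lambda>_. \<mu>)"
  have "Pi_pmf A d (\<lambda>_. \<mu>) = Pi_pmf (insert a (A - {a})) d (\<lambda>_. \<mu>)"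
    using assms(2) by (simp add: insert_absorb)
  also have "\<dots> = map_pmf (\<lambda>(x, C). C(a := x)) (pair_pmf \<mu> ?P)"
    using assms(1) by (intro Pi_pmf_insert) auto
  finally have "measure_pmf.prob (Pi_pmf A d (\<lambda>_. \<mu>)) {C. C a = C b}
      = measure_pmf.prob (pair_pmf \<mu> ?P) {(x, C). x = C b}"
    using assms(3) by (simp add: vimage_def case_prod_unfold)
  also have "\<dots> = pmf (map_pmf (\<lambda>(x, C). x = C b) (pair_pmf \<mu> ?P)) True"
    by (simp add: pmf_map vimage_def case_prod_unfold)
  also have "map_pmf (\<lambda>(x, C). x = C b) (pair_pmf \<mu> ?P)
      = bind_pmf ?P (\<lambda>C. map_pmf (\<lambda>x. x = C b) \<mu>)"
    unfolding pair_pmf_def map_pmf_def bind_assoc_pmf bind_return_pmf case_prod_conv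
    by (rule bind_commute_pmf)
  also have "pmf \<dots> True = measure_pmf.expectation ?P (\<lambda>C. pmf \<mu> (C b))"
    by (simp add: pmf_bind pmf_map vimage_def measure_pmf_single)
  also have "\<dots> \<le> c"
    using assms(4)
    by (intro measure_pmf.integral_le_const measure_pmf.integrable_const_bound[where B = 1])
       (auto simp: pmf_le_1)
  finally show ?thesis .
qed

lemma prob_not_inj_le:
  assumes "\<And>x. pmf \<mu> x \<le> c"
  shows "measure_pmf.prob (Pi_pmf {1..k} d (\<lambda>_. \<mu>)) {C. \<not> inj_on C {1..k}} \<le> real k ^ 2 * c"
proof -
  let ?M = "Pi_pmf {1..k} d (\<lambda>_. \<mu>)"
  let ?I = "{(a, b) \<in> {1..k} \<times> {1..k}. a \<noteq> b}"
  have fin: "finite ?I" by (rule finite_subset[of _ "{1..k} \<times> {1..k}"]) auto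
  have "0 \<le> c" by (rule order_trans[OF pmf_nonneg assms])
  have "measure_pmf.prob ?M {C. \<not> inj_on C {1..k}}
      \<le> measure_pmf.prob ?M (\<Union>(a, b)\<in>?I. {C. C a = C b})"
    by (rule measure_pmf.finite_measure_mono) (auto simp: inj_on_def, blast)
  also have "\<dots> \<le> (\<Sum>(a, b)\<in>?I. measure_pmf.prob ?M {C. C a = C b})"
    using measure_pmf.finite_measure_subadditive_finite[OF fin, of "\<lambda>(a, b). {C. C a = C b}" ?M]
    by (simp add: case_prod_unfold)
  also have "\<dots> \<le> (\<Sum>(a, b)\<in>?I. c)"
    using assms by (intro sum_mono) (auto intro!: prob_two_coordinates_eq_le)
  also have "\<dots> = real (card ?I) * c" by simp
  also have "\<dots> \<le> real (card ({1..k} \<times> {1..k})) * c"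
    using \<open>0 \<le> c\<close> by (intro mult_right_mono of_nat_mono card_mono) auto
  finally show ?thesis by (simp add: power2_eq_square)
qed

text \<open>
  The events that the patterns \<open>\<pi> \<circ> \<tau>\<close> occur are disjoint and equally likely, and together they
  cover everything except ties.
\<close>

lemma fact_times_prob_pattern_bound:
  assumes "total_ordering_pattern k \<pi>" "\<And>x. pmf \<mu> x \<le> c"
  shows "\<bar>fact k * measure_pmf.prob (Pi_pmf {1..k} d (\<lambda>_. \<mu>))
            {C. consecutive_pattern_occurs_at k \<pi> 1 C} - 1\<bar> \<le> real k ^ 2 * c"
proof -
  let ?M = "Pi_pmf {1..k} d (\<lambda>_. \<mu>)"
  let ?S = "{\<tau>. \<tau> permutes {1..k}}"
  let ?E = "\<lambda>\<tau>. {C. consecutive_pattern_occurs_at k (\<pi> \<circ> \<tau>) 1 C}"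
  have fin: "finite ?S" by (simp add: finite_permutations)
  have "measure_pmf.prob ?M (\<Union>\<tau>\<in>?S. ?E \<tau>) = (\<Sum>\<tau>\<in>?S. measure_pmf.prob ?M (?E \<tau>))"
    using fin patterns_comp_permutes_disjoint[OF assms(1)]
    by (intro measure_pmf.finite_measure_finite_Union) (auto simp: disjoint_family_on_def)
  also have "\<dots> = fact k * measure_pmf.prob ?M {C. consecutive_pattern_occurs_at k \<pi> 1 C}"
    using card_permutations[of "{1..k}" k] by (simp add: prob_permuted_pattern del: One_nat_def)
  finally have union: "measure_pmf.prob ?M (\<Union>\<tau>\<in>?S. ?E \<tau>)
      = fact k * measure_pmf.prob ?M {C. consecutive_pattern_occurs_at k \<pi> 1 C}" .
  have "1 - measure_pmf.prob ?M (\<Union>\<tau>\<in>?S. ?E \<tau>) = measure_pmf.prob ?M (UNIV - (\<Union>\<tau>\<in>?S. ?E \<tau>))"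
    using measure_pmf.prob_compl[of "\<Union>\<tau>\<in>?S. ?E \<tau>" ?M] by simp
  also have "\<dots> \<le> measure_pmf.prob ?M {C. \<not> inj_on C {1..k}}"
    using ex_permuted_pattern_occurs[OF assms(1)]
    by (intro measure_pmf.finite_measure_mono) auto
  also have "\<dots> \<le> real k ^ 2 * c" using assms(2) by (rule prob_not_inj_le)
  finally show ?thesis
    unfolding union[symmetric] using measure_pmf.prob_le_1[of ?M "\<Union>\<tau>\<in>?S. ?E \<tau>"]
    by linarith
qed

section \<open>Geometric compositions\<close>

text \<open>
  The marginal law of a window is a product of independent copies of the same geometric law, so
  shifting the window to \<open>{1..k}\<close> turns it into a geometric random \<open>k\<close>-composition.
\<close>

lemma prob_pattern_window:
  assumes "l \<in> {1..n + 1 - k}"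
  shows "measure_pmf.prob (geometric_composition n p) {C. consecutive_pattern_occurs_at k \<pi> l C}
       = measure_pmf.prob (geometric_composition k p) {C. consecutive_pattern_occurs_at k \<pi> 1 C}"
proof -
  let ?W = "(+) (l - 1) ` {1..k}"
  let ?g = "\<lambda>_. geometric_pmf (1 - p)"
  have "geometric_composition k p = map_pmf (\<lambda>C. C \<circ> (+) (l - 1)) (Pi_pmf ?W 0 ?g)"
    unfolding geometric_composition_def by (intro Pi_pmf_bij_betw) (auto simp: bij_betw_def)
  also have "Pi_pmf ?W 0 ?g = map_pmf (\<lambda>C x. if x \<in> ?W then C x else 0) (geometric_composition n p)"
    unfolding geometric_composition_def using assms by (intro Pi_pmf_subset) auto
  finally have *: "geometric_composition k p
      = map_pmf (\<lambda>C a. if l - 1 + a \<in> ?W then C (l - 1 + a) else 0) (geometric_composition n p)"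
    by (simp only: pmf.map_comp comp_def)
  show ?thesis
    unfolding * by (simp add: vimage_def consecutive_pattern_occurs_at_def)
qed

theorem proposition4p16:
  fixes k :: nat and \<pi> :: "nat \<Rightarrow> nat" and p q :: "nat \<Rightarrow> real" and i :: "nat \<Rightarrow> nat"
  assumes "total_ordering_pattern k \<pi>"
    and "\<And>n. 0 \<le> p n \<and> p n < 1"
    and "\<And>n. q n = 1 - p n"
    and "q \<longlonglongrightarrow> 0"
    and "\<forall>\<^sub>F n in sequentially. i n \<in> {1..n + 1 - k}"
  shows "(\<lambda>n. measure_pmf.prob (geometric_composition n (p n))
            {C. consecutive_pattern_occurs_at k \<pi> (i n) C}) \<longlonglongrightarrow> 1 / fact k"
proof -
  let ?P = "\<lambda>n. measure_pmf.prob (geometric_composition k (p n))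
      {C. consecutive_pattern_occurs_at k \<pi> 1 C}"
  have bound: "\<bar>fact k * ?P n - 1\<bar> \<le> real k ^ 2 * q n" for n
  proof -
    have "pmf (geometric_pmf (1 - p n)) j \<le> q n" for j
      using assms(2)[of n] by (simp add: assms(3) mult_left_le_one_le power_le_one)
    then show ?thesis
      unfolding geometric_composition_def by (intro fact_times_prob_pattern_bound assms(1))
  qed
  have "(\<lambda>n. real k ^ 2 * q n) \<longlonglongrightarrow> 0"
    using tendsto_mult_right_zero[OF assms(4)] by simp
  then have "(\<lambda>n. fact k * ?P n - 1) \<longlonglongrightarrow> 0"
    by (rule Lim_null_comparison[rotated]) (use bound in simp)
  then have "(\<lambda>n. fact k * ?P n) \<longlonglongrightarrow> 1"
    by (simp add: LIM_zero_iff)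
  then have "(\<lambda>n. fact k * ?P n / fact k) \<longlonglongrightarrow> 1 / fact k"
    by (intro tendsto_intros) auto
  then have "?P \<longlonglongrightarrow> 1 / fact k" by simp
  moreover have "\<forall>\<^sub>F n in sequentially. ?P n = measure_pmf.prob (geometric_composition n (p n))
      {C. consecutive_pattern_occurs_at k \<pi> (i n) C}"
    using assms(5) by eventually_elim (rule prob_pattern_window[symmetric])
  ultimately show ?thesis by (rule Lim_transform_eventually)
qed

end
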